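(* Let $a<b$ be real numbers and let $F\in C^1([a,b]\times\mathbb{R}^2)$ be a real-valued function, written $F=F(x,p,q)$. Let $(x_0,p_0,q_0)$ be such that $x_0\in(a,b)$, $p_0,q_0\in\mathbb{R}$, $F(x_0,p_0,q_0)=0$ and $\partial_q F(x_0,p_0,q_0)\neq 0$. Then there exist $\delta>0$, $\rho>0$, a function $u\in C^1([x_0-\delta,x_0+\delta])$ and a function $\phi\in C^0([x_0-\delta,x_0+\delta]\times[p_0-\rho,p_0+\rho])$ such that $\phi(x_0,p_0)=q_0$ and $$u'(x)=\phi(x,u(x)),\qquad F(x,u(x),\phi(x,u(x)))=0\qquad \text{for all } x\in[x_0-\delta,x_0+\delta].$$
   Context: The ordinary differential equation under consideration is $F(x,y(x),y'(x))=0$ on $[a,b]$, with real-valued unknown $y$. $\partial_q F$ denotes the partial derivative of $F(x,p,q)$ with respect to its third variable $q$. The interval $[x_0-\delta,x_0+\delta]$ is understood to be contained in $[a,b]$, and writing $\phi(x,u(x))$ means that $u(x)\in[p_0-\rho,p_0+\rho]$ for all $x\in[x_0-\delta,x_0+\delta]$. *)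

theory Defs
  imports "HOL-Analysis.Analysis"
begin

text \<open>
  The class \<open>C\<^sup>1(S)\<close> for a set \<open>S\<close> that need not be open: the Frechet derivative is taken
  relative to \<open>S\<close> (one-sided on the boundary) and is continuous on \<open>S\<close> in the operator norm. It
  is meant for convex \<open>S\<close> with nonempty interior, where this derivative is unique. The
  library's \<open>C1_differentiable_on\<close> covers functions of one real variable only and demands
  two-sided derivatives at the endpoints of an interval.
\<close>

definition C1_on :: "('a::real_normed_vector \<Rightarrow> 'b::real_normed_vector) \<Rightarrow> 'a set \<Rightarrow> bool"
  where "C1_on f S \<longleftrightarrow>
    (\<exists>f' :: 'a \<Rightarrow> 'a \<Rightarrow>\<^sub>L 'b.
      (\<forall>x\<in>S. (f has_derivative blinfun_apply (f' x)) (at x within S)) \<and> continuous_on S f')"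

end

theory Submission
  imports Defs
begin

text \<open>
  Instead of solving first for \<open>q\<close> and then applying Picard's theorem, solve for the derivative
  \<open>v = u'\<close> in one step. With \<open>c = \<partial>\<^sub>q F(x\<^sub>0, p\<^sub>0, q\<^sub>0)\<close>, the equation is the fixed point equation
  \<open>v(x) = v(x) - F(x, p\<^sub>0 + \<integral>\<^bsub>x\<^sub>0\<^esub>\<^bsup>x\<^esup> v, v(x)) / c\<close>. By strict differentiability of \<open>F\<close> the right-hand
  side is, near \<open>(x\<^sub>0, p\<^sub>0, q\<^sub>0)\<close>, Lipschitz in \<open>q\<close> with constant \<open>1/4\<close> and Lipschitz in \<open>p\<close>, and the
  integral over a short interval makes the second constant small. So it is a contraction in the
  uniform norm. Then \<open>u(x) = p\<^sub>0 + \<integral>\<^bsub>x\<^sub>0\<^esub>\<^bsup>x\<^esup> v\<close> and \<open>\<phi>(x, p) = v(x)\<close> are as required.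
\<close>

text \<open>The oriented integral of \<open>w\<close> from \<open>x0\<close> to \<open>x\<close>,
  where \<open>x\<close> may lie on either side of \<open>x0\<close>. It is a difference of
  integrals from the left end \<open>s\<close>, since \<open>integral {x0..x} w\<close> would be
  \<open>0\<close> for \<open>x < x0\<close>.\<close>

definition integral_from :: "real \<Rightarrow> real \<Rightarrow> (real \<Rightarrow> real) \<Rightarrow> real \<Rightarrow> real"
  where "integral_from s x0 w x = integral {s..x} w - integral {s..x0} w"

lemma integral_from_self [simp]: "integral_from s x0 w x0 = 0"
  by (simp add: integral_from_def)

lemma integral_from_has_real_derivative:
  assumes "continuous_on {s..e} w" "x \<in> {s..e}"
  shows "(integral_from s x0 w has_real_derivative w x) (at x within {s..e})"
  unfolding integral_from_def[abs_def]
  using integral_has_real_derivative[OF assms] by (auto intro!: derivative_eq_intros)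

lemma continuous_on_integral_from:
  assumes "continuous_on {s..e} w"
  shows "continuous_on {s..e} (integral_from s x0 w)"
  using integral_from_has_real_derivative[OF assms] by (rule DERIV_continuous_on)

lemma integral_from_diff:
  assumes "continuous_on {s..e} v" "continuous_on {s..e} w" "x \<in> {s..e}" "x0 \<in> {s..e}"
  shows "integral_from s x0 v x - integral_from s x0 w x = integral_from s x0 (\<lambda>y. v y - w y) x"
proof -
  have "integral {s..y} (\<lambda>y. v y - w y) = integral {s..y} v - integral {s..y} w"
    if "y \<in> {s..e}" for y
    using that by (intro integral_diff integrable_continuous_real
        continuous_on_subset[OF assms(1)] continuous_on_subset[OF assms(2)]) auto
  with assms show ?thesis
    by (simp add: integral_from_def)
qed

text \<open>Both integrals are bounded over the whole interval, hence the factor 2. This crude bound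
  suffices: it only has to vanish with the length \<open>e - s\<close>.\<close>

lemma abs_integral_from_le:
  assumes w: "continuous_on {s..e} w" and B: "\<And>y. y \<in> {s..e} \<Longrightarrow> \<bar>w y\<bar> \<le> B"
    and "x \<in> {s..e}" "x0 \<in> {s..e}"
  shows "\<bar>integral_from s x0 w x\<bar> \<le> 2 * (e - s) * B"
proof -
  have "0 \<le> B"
    using B[OF assms(3)] by linarith
  have "\<bar>integral {s..y} w\<bar> \<le> (e - s) * B" if "y \<in> {s..e}" for y
  proof -
    have "norm (integral {s..y} w) \<le> B * (y - s)"
      using that by (intro integral_bound continuous_on_subset[OF w]) (auto intro: B)
    also have "\<dots> \<le> B * (e - s)"
      using that \<open>0 \<le> B\<close> by (intro mult_left_mono) auto
    finally show ?thesis
      by (simp add: mult.commute)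
  qed
  from this[OF assms(3)] this[OF assms(4)]
  have "\<bar>integral {s..x} w - integral {s..x0} w\<bar> \<le> (e - s) * B + (e - s) * B"
    by linarith
  then show ?thesis
    by (simp add: integral_from_def algebra_simps)
qed

text \<open>Banach's theorem in the uniform norm for the map taking \<open>v\<close> to the function
  \<open>h (x, p0 + integral_from s x0 v x, v x)\<close> of \<open>x\<close>, on the
  \<open>v\<close> within \<open>r\<close> of \<open>q0\<close>. The first condition in
  \<open>small\<close> keeps the second argument of \<open>h\<close> in its box, the second gives
  the contraction, and the third, with \<open>near\<close>, gives the self-map.\<close>

lemma integral_fixed_point:
  fixes h :: "real \<times> real \<times> real \<Rightarrow> real"
  assumes cont: "continuous_on ({s..e} \<times> {p0 - r..p0 + r} \<times> {q0 - r..q0 + r}) h"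
    and lip: "\<And>x p p' q q'. x \<in> {s..e} \<Longrightarrow> p \<in> {p0 - r..p0 + r} \<Longrightarrow> p' \<in> {p0 - r..p0 + r} \<Longrightarrow>
      q \<in> {q0 - r..q0 + r} \<Longrightarrow> q' \<in> {q0 - r..q0 + r} \<Longrightarrow>
      \<bar>h (x, p, q) - h (x, p', q')\<bar> \<le> M * \<bar>p - p'\<bar> + \<bar>q - q'\<bar> / 4"
    and near: "\<And>x. x \<in> {s..e} \<Longrightarrow> \<bar>h (x, p0, q0) - q0\<bar> \<le> r / 4"
    and x0: "x0 \<in> {s..e}" and r: "0 < r" and M: "0 \<le> M"
    and small: "2 * (e - s) * (\<bar>q0\<bar> + r) \<le> r" "2 * (e - s) * M \<le> 1 / 4"
      "M * (2 * (e - s) * (\<bar>q0\<bar> + r)) \<le> r / 4"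
  obtains v where "continuous_on {s..e} v"
    and "\<And>x. x \<in> {s..e} \<Longrightarrow> v x \<in> {q0 - r..q0 + r}"
    and "\<And>x. x \<in> {s..e} \<Longrightarrow> p0 + integral_from s x0 v x \<in> {p0 - r..p0 + r}"
    and "\<And>x. x \<in> {s..e} \<Longrightarrow> h (x, p0 + integral_from s x0 v x, v x) = v x"
proof -
  \<comment> \<open>Functions on \<open>{s..e}\<close> are extended constantly to the line, where bounded continuous
    functions form a complete metric space.\<close>
  define k where "k x = max s (min e x)" for x
  have k_cont: "continuous_on UNIV k"
    unfolding k_def by (intro continuous_intros)
  have k_in: "k x \<in> {s..e}" and k_id: "x \<in> {s..e} \<Longrightarrow> k x = x" for x
    using x0 by (auto simp: k_def)
  let ?I = "\<lambda>w::real \<Rightarrow>\<^sub>C real. integral_from s x0 (apply_bcontfun w)"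
  define T where "T w x = h (k x, p0 + ?I w (k x), apply_bcontfun w (k x))" for w x
  define S where "S = cball (const_bcontfun q0 :: real \<Rightarrow>\<^sub>C real) r"
  have S_iff: "w \<in> S \<longleftrightarrow> (\<forall>x. \<bar>w x - q0\<bar> \<le> r)" for w :: "real \<Rightarrow>\<^sub>C real"
  proof
    assume w: "w \<in> S"
    show "\<forall>x. \<bar>w x - q0\<bar> \<le> r"
    proof
      fix x
      show "\<bar>w x - q0\<bar> \<le> r"
        using dist_bounded[of "const_bcontfun q0" x w] w by (simp add: S_def dist_real_def abs_minus_commute)
    qed
  next
    assume "\<forall>x. \<bar>w x - q0\<bar> \<le> r"
    then show "w \<in> S"
      unfolding S_def mem_cball by (intro dist_bound) (simp add: dist_real_def abs_minus_commute)
  qed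
  have S_in: "apply_bcontfun w x \<in> {q0 - r..q0 + r}" if "w \<in> S" for w x
    using that[unfolded S_iff, rule_format, of x] by (auto simp: abs_le_iff)
  have I_small: "\<bar>?I w x\<bar> \<le> 2 * (e - s) * (\<bar>q0\<bar> + r)" if "w \<in> S" "x \<in> {s..e}" for w x
  proof (rule abs_integral_from_le)
    show "\<bar>w y\<bar> \<le> \<bar>q0\<bar> + r" for y
      using that(1)[unfolded S_iff, rule_format, of y] by linarith
  qed (use that x0 in auto)
  have I_in: "p0 + ?I w x \<in> {p0 - r..p0 + r}" if "w \<in> S" "x \<in> {s..e}" for w x
    using I_small[OF that] small(1) by (auto simp: abs_le_iff)
  have T_S: "\<bar>T w x - q0\<bar> \<le> r" if "w \<in> S" for w x
  proof -
    \<comment> \<open>Comparison with the centre \<open>(p0, q0)\<close>: the two Lipschitz terms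
      contribute \<open>r / 4\<close> each and \<open>near\<close> another \<open>r / 4\<close>, in
      total less than \<open>r\<close>.\<close>
    have "\<bar>T w x - h (k x, p0, q0)\<bar> \<le> M * \<bar>?I w (k x)\<bar> + \<bar>w (k x) - q0\<bar> / 4"
      unfolding T_def using lip[OF k_in I_in[OF that k_in] _ S_in[OF that], of p0 q0 x] r by simp
    also have "\<dots> \<le> r / 4 + r / 4"
    proof (rule add_mono)
      show "M * \<bar>?I w (k x)\<bar> \<le> r / 4"
        using mult_left_mono[OF I_small[OF that k_in] M] small(3) by (rule order_trans)
      show "\<bar>w (k x) - q0\<bar> / 4 \<le> r / 4"
        using that S_iff by simp
    qed
    finally show ?thesis
      using near[OF k_in[of x]] r by linarith
  qed
  have T_cont: "continuous_on UNIV (T w)" if "w \<in> S" for w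
  proof -
    have "continuous_on UNIV (\<lambda>x. ?I w (k x))"
      by (rule continuous_on_compose2[OF continuous_on_integral_from[of s e] k_cont])
        (use k_in in blast)+
    moreover have "continuous_on UNIV (\<lambda>x. w (k x))"
      by (rule continuous_on_compose2[OF continuous_on_apply_bcontfun k_cont]) (rule subset_UNIV)
    ultimately have "continuous_on UNIV (\<lambda>x. (k x, p0 + ?I w (k x), w (k x)))"
      by (intro continuous_on_Pair continuous_on_add continuous_on_const k_cont)
    moreover have "(\<lambda>x. (k x, p0 + ?I w (k x), w (k x))) ` UNIV
        \<subseteq> {s..e} \<times> {p0 - r..p0 + r} \<times> {q0 - r..q0 + r}"
      using k_in I_in[OF that k_in] S_in[OF that] by blast
    ultimately show ?thesis
      unfolding T_def[abs_def] by (rule continuous_on_compose2[OF cont])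
  qed
  \<comment> \<open>\<open>Bcontfun\<close> is inverted by \<open>apply_bcontfun\<close> only on
    bounded continuous functions; this makes the abstract fixed point equation readable
    pointwise.\<close>
  have T_bcontfun: "apply_bcontfun (Bcontfun (T w)) = T w" if "w \<in> S" for w
  proof (rule Bcontfun_inverse, rule bcontfun_normI)
    show "norm (T w x) \<le> \<bar>q0\<bar> + r" for x
      using T_S[OF that, of x] by simp
  qed (rule T_cont[OF that])
  have "\<exists>!w\<in>S. Bcontfun (T w) = w"
  proof (rule Banach_fix)
    show "complete S"
      by (simp add: S_def complete_eq_closed)
    show "S \<noteq> {}"
      using r by (simp add: S_def)
    show "(\<lambda>w. Bcontfun (T w)) ` S \<subseteq> S"
      using T_S by (auto simp: S_iff[of "Bcontfun _"] T_bcontfun)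
    show "dist (Bcontfun (T v)) (Bcontfun (T w)) \<le> 1 / 2 * dist v w" if "v \<in> S" "w \<in> S" for v w
    proof (rule dist_bound)
      fix x
      have d: "\<bar>v y - w y\<bar> \<le> dist v w" for y
        using dist_bounded[of v y w] by (simp add: dist_real_def)
      have "\<bar>?I v (k x) - ?I w (k x)\<bar> \<le> 2 * (e - s) * dist v w"
        unfolding integral_from_diff[OF continuous_on_apply_bcontfun continuous_on_apply_bcontfun k_in x0]
        by (rule abs_integral_from_le[OF _ d k_in x0])
          (intro continuous_on_diff continuous_on_apply_bcontfun)
      then have "M * \<bar>?I v (k x) - ?I w (k x)\<bar> \<le> M * (2 * (e - s) * dist v w)"
        using M by (rule mult_left_mono)
      also have "\<dots> = 2 * (e - s) * M * dist v w"
        by simp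
      also have "\<dots> \<le> 1 / 4 * dist v w"
        using small(2) by (rule mult_right_mono) simp
      \<comment> \<open>The integral and the pointwise value of \<open>v - w\<close> each contribute
        a factor 1/4.\<close>
      finally have "\<bar>T v x - T w x\<bar> \<le> 1 / 2 * dist v w"
        unfolding T_def
        using lip[OF k_in[of x] I_in[OF that(1) k_in[of x]] I_in[OF that(2) k_in[of x]]
            S_in[OF that(1), of "k x"] S_in[OF that(2), of "k x"]] d[of "k x"]
        by simp
      then show "dist (Bcontfun (T v) x) (Bcontfun (T w) x) \<le> 1 / 2 * dist v w"
        by (simp add: T_bcontfun that dist_real_def)
    qed
  qed auto
  then obtain w where w: "w \<in> S" "Bcontfun (T w) = w"
    by blast
  show ?thesis
  proof (rule that)
    show "h (x, p0 + ?I w x, w x) = w x" if "x \<in> {s..e}" for x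
      using T_bcontfun[OF w(1)] k_id[OF that] unfolding w(2) by (metis T_def)
  qed (use w I_in S_in in auto)
qed

text \<open>Near \<open>z0\<close> the derivative is within \<open>\<epsilon>\<close> of
  \<open>f' z0\<close> in operator norm. The mean value inequality for \<open>f\<close> minus this
  linear map then applies on the convex set \<open>S \<inter> ball z0 d\<close>, which contains the
  segments between its points.\<close>

lemma C1_on_strict_derivative:
  assumes f': "\<And>z. z \<in> S \<Longrightarrow> (f has_derivative blinfun_apply (f' z)) (at z within S)"
    and cont: "continuous_on S f'" and S: "convex S" "z0 \<in> S" and "0 < \<epsilon>"
  obtains d where "0 < d"
    and "\<And>y z. y \<in> S \<inter> ball z0 d \<Longrightarrow> z \<in> S \<inter> ball z0 d \<Longrightarrow>
      norm (f z - f y - blinfun_apply (f' z0) (z - y)) \<le> norm (z - y) * \<epsilon>"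
proof -
  from cont S(2) \<open>0 < \<epsilon>\<close> obtain d where d: "0 < d"
    "\<And>z. z \<in> S \<Longrightarrow> dist z z0 < d \<Longrightarrow> dist (f' z) (f' z0) < \<epsilon>"
    unfolding continuous_on_iff by blast
  have *: "norm (f z - f y - blinfun_apply (f' z0) (z - y)) \<le> norm (z - y) * \<epsilon>"
    if yz: "y \<in> S \<inter> ball z0 d" "z \<in> S \<inter> ball z0 d" for y z
  proof (rule differentiable_bound_linearization[where S = "S \<inter> ball z0 d"])
    show "y + t *\<^sub>R (z - y) \<in> S \<inter> ball z0 d" if "t \<in> {0..1}" for t
    proof -
      have "convex (S \<inter> ball z0 d)"
        using S(1) by (simp add: convex_Int)
      from convexD_alt[OF this yz, of t] that show ?thesis
        by (simp add: algebra_simps)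
    qed
    show "(f has_derivative blinfun_apply (f' x)) (at x within S \<inter> ball z0 d)"
      if "x \<in> S \<inter> ball z0 d" for x
      using that by (auto intro: has_derivative_subset[OF f'])
    show "onorm (blinfun_apply (f' x) - blinfun_apply (f' z0)) \<le> \<epsilon>"
      if "x \<in> S \<inter> ball z0 d" for x
      using d(2)[of x] that
      by (simp add: dist_norm norm_blinfun.rep_eq fun_diff_def blinfun.diff_left[abs_def] norm_minus_commute
          dist_commute)
    show "z0 \<in> S \<inter> ball z0 d"
      using S d by simp
  qed
  with d(1) show ?thesis
    by (rule that)
qed

lemma C1_on_real_derivative:
  fixes u :: "real \<Rightarrow> real"
  assumes "\<And>x. x \<in> S \<Longrightarrow> (u has_real_derivative v x) (at x within S)" "continuous_on S v"
  shows "C1_on u S"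
  unfolding C1_on_def
proof (intro exI conjI ballI)
  show "(u has_derivative blinfun_apply (blinfun_scaleR_left (v x))) (at x within S)" if "x \<in> S" for x
    using assms(1)[OF that] by (simp add: has_field_derivative_def mult_commute_abs)
  show "continuous_on S (\<lambda>x. blinfun_scaleR_left (v x))"
    using assms(2) by (intro continuous_intros)
qed

text \<open>The smallness conditions compare continuous functions of \<open>\<delta>\<close> with
  bounds that hold strictly at \<open>\<delta> = 0\<close>, so they hold together for all small
  \<open>\<delta> > 0\<close>. The factor \<open>4 * \<delta>\<close> is \<open>2 * (e - s)\<close>
  for an interval of length \<open>2 * \<delta>\<close>.\<close>

lemma small_interval_exists:
  fixes a b x0 :: real and f :: "real \<Rightarrow> real"
  assumes f: "continuous_on {a..b} f" and x0: "x0 \<in> {a<..<b}" and f0: "f x0 = 0"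
    and pos: "0 < r" "0 < \<eta>" "0 \<le> M" "0 \<le> B"
  obtains \<delta> where "0 < \<delta>" "\<delta> \<le> r" "{x0 - \<delta>..x0 + \<delta>} \<subseteq> {a..b}" "4 * \<delta> * B \<le> r"
    "4 * \<delta> * M \<le> 1 / 4" "M * (4 * \<delta> * B) \<le> r / 4"
    "\<And>x. x \<in> {x0 - \<delta>..x0 + \<delta>} \<Longrightarrow> \<bar>f x\<bar> \<le> \<eta>"
proof -
  have "x0 \<in> {a..b}"
    using x0 by simp
  with f pos(2) obtain d where d: "0 < d"
    "\<And>x. x \<in> {a..b} \<Longrightarrow> dist x x0 < d \<Longrightarrow> dist (f x) (f x0) < \<eta>"
    unfolding continuous_on_iff by blast
  have ev: "eventually (\<lambda>\<delta>. g \<delta> < c) (at_right 0)"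
    if "continuous_on UNIV g" "g 0 < c" for g :: "real \<Rightarrow> real" and c
    using that by (intro order_tendstoD(2)[of g "g 0"])
      (auto simp: continuous_on_def intro: tendsto_within_subset)
  have "eventually (\<lambda>\<delta>. 0 < \<delta> \<and> \<delta> < r \<and> \<delta> < d \<and> \<delta> < x0 - a \<and> \<delta> < b - x0 \<and> 4 * \<delta> * B < r \<and>
      4 * \<delta> * M < 1 / 4 \<and> M * (4 * \<delta> * B) < r / 4) (at_right 0)"
    using x0 pos d by (intro eventually_conj ev eventually_at_right_less continuous_intros) auto
  then obtain \<delta> where \<delta>: "0 < \<delta>" "\<delta> < r" "\<delta> < d" "\<delta> < x0 - a" "\<delta> < b - x0" "4 * \<delta> * B < r"
      "4 * \<delta> * M < 1 / 4" "M * (4 * \<delta> * B) < r / 4"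
    using eventually_happens'[OF trivial_limit_at_right_real] by blast
  have "\<bar>f x\<bar> \<le> \<eta>" if "x \<in> {x0 - \<delta>..x0 + \<delta>}" for x
    using d(2)[of x] that \<delta> f0 by (auto simp: dist_real_def abs_less_iff)
  with \<delta> show ?thesis
    by (intro that[of \<delta>]) auto
qed

theorem theorem1:
  fixes a b x0 p0 q0 :: real
    and F :: "real \<times> real \<times> real \<Rightarrow> real"
  assumes "a < b"
    and "C1_on F ({a..b} \<times> UNIV \<times> UNIV)"
    and "x0 \<in> {a<..<b}"
    and "F (x0, p0, q0) = 0"
    and "deriv (\<lambda>q. F (x0, p0, q)) q0 \<noteq> 0"
  shows "\<exists>\<delta>>0. \<exists>\<rho>>0. \<exists>(u :: real \<Rightarrow> real) (\<phi> :: real \<times> real \<Rightarrow> real).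
    {x0 - \<delta>..x0 + \<delta>} \<subseteq> {a..b} \<and>
    C1_on u {x0 - \<delta>..x0 + \<delta>} \<and>
    continuous_on ({x0 - \<delta>..x0 + \<delta>} \<times> {p0 - \<rho>..p0 + \<rho>}) \<phi> \<and>
    \<phi> (x0, p0) = q0 \<and>
    (\<forall>x\<in>{x0 - \<delta>..x0 + \<delta>}.
      u x \<in> {p0 - \<rho>..p0 + \<rho>} \<and>
      (u has_real_derivative \<phi> (x, u x)) (at x within {x0 - \<delta>..x0 + \<delta>}) \<and>
      F (x, u x, \<phi> (x, u x)) = 0)"
proof -
  let ?S = "{a..b} \<times> (UNIV :: (real \<times> real) set)"
  let ?z0 = "(x0, p0, q0)"
  from assms(2) obtain F' where
    F': "\<And>z. z \<in> ?S \<Longrightarrow> (F has_derivative blinfun_apply (F' z)) (at z within ?S)"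
    and F'_cont: "continuous_on ?S F'"
    unfolding C1_on_def by auto
  have z0: "?z0 \<in> ?S"
    using assms(3) by auto
  have F_cont: "continuous_on ?S F"
    using has_derivative_continuous_on[of ?S F "\<lambda>z. blinfun_apply (F' z)"] F' by simp
  have Fx_cont: "continuous_on {a..b} (\<lambda>x. F (x, p0, q0))"
    by (intro continuous_on_compose2[OF F_cont] continuous_intros) auto
  \<comment> \<open>\<open>c\<close> and \<open>D\<close> are the partial derivatives of
    \<open>F\<close> in \<open>q\<close> and \<open>p\<close> at the base point. They determine the
    total derivative on increments with fixed \<open>x\<close>.\<close>
  define c where "c = blinfun_apply (F' ?z0) (0, 0, 1)"
  define D where "D = blinfun_apply (F' ?z0) (0, 1, 0)"
  have F'_eq: "blinfun_apply (F' ?z0) (0, p, q) = p * D + q * c" for p q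
  proof -
    have "blinfun_apply (F' ?z0) (0, p, q)
        = blinfun_apply (F' ?z0) (p *\<^sub>R (0, 1, 0) + q *\<^sub>R (0, 0, 1))"
      by simp
    then show ?thesis
      unfolding blinfun.add_right blinfun.scaleR_right by (simp add: c_def D_def)
  qed
  \<comment> \<open>The line in direction \<open>q\<close> stays inside \<open>?S\<close>, so the
    chain rule turns the relative derivative into a two-sided one and identifies \<open>c\<close>
    with the given \<open>deriv\<close>.\<close>
  have "((\<lambda>q. F (x0, p0, q)) has_derivative (\<lambda>q. blinfun_apply (F' ?z0) (0, 0, q))) (at q0)"
    by (rule has_derivative_in_compose2[OF F', where f = "\<lambda>q. (x0, p0, q)" and s = UNIV])
      (use assms(3) in \<open>auto intro!: derivative_eq_intros\<close>)
  then have "((\<lambda>q. F (x0, p0, q)) has_real_derivative c) (at q0)"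
    by (simp add: F'_eq has_field_derivative_def mult_commute_abs)
  with assms(5) have c: "c \<noteq> 0"
    by (simp add: DERIV_imp_deriv)
  have "convex ?S"
    by (intro convex_Times) auto
  \<comment> \<open>The tolerance \<open>\<bar>c\<bar> / 4\<close> becomes the Lipschitz constant
    1/4 after division by \<open>c\<close>.\<close>
  then obtain d where d: "0 < d"
    "\<And>y z. y \<in> ?S \<inter> ball ?z0 d \<Longrightarrow> z \<in> ?S \<inter> ball ?z0 d \<Longrightarrow>
      norm (F z - F y - blinfun_apply (F' ?z0) (z - y)) \<le> norm (z - y) * (\<bar>c\<bar> / 4)"
    using C1_on_strict_derivative[OF F' F'_cont _ z0, of "\<bar>c\<bar> / 4"] c by auto
  \<comment> \<open>Three coordinate deviations of at most \<open>r\<close> add up to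
    \<open>3 * d / 4 < d\<close>, so the box lies in the ball.\<close>
  define r where "r = d / 4"
  \<comment> \<open>\<open>\<bar>D\<bar> / \<bar>c\<bar>\<close> comes from the linear term in
    \<open>p\<close>, 1/4 from the remainder.\<close>
  define M where "M = \<bar>D\<bar> / \<bar>c\<bar> + 1 / 4"
  have pos: "0 < r" "0 \<le> M" "0 \<le> \<bar>q0\<bar> + r" "0 < \<bar>c\<bar> * r / 4"
    using d(1) c by (auto simp: r_def M_def)
  \<comment> \<open>A Newton step in \<open>q\<close> with the slope frozen at \<open>c\<close>:
    \<open>h z\<close> equals the \<open>q\<close>-component of \<open>z\<close> exactly when
    \<open>F z = 0\<close>.\<close>
  define h where "h z = snd (snd z) - F z / c" for z
  obtain \<delta> where \<delta>: "0 < \<delta>" "\<delta> \<le> r" "{x0 - \<delta>..x0 + \<delta>} \<subseteq> {a..b}" "4 * \<delta> * (\<bar>q0\<bar> + r) \<le> r"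
    "4 * \<delta> * M \<le> 1 / 4" "M * (4 * \<delta> * (\<bar>q0\<bar> + r)) \<le> r / 4"
    "\<And>x. x \<in> {x0 - \<delta>..x0 + \<delta>} \<Longrightarrow> \<bar>F (x, p0, q0)\<bar> \<le> \<bar>c\<bar> * r / 4"
    using small_interval_exists[OF Fx_cont assms(3,4) pos(1,4,2,3)] by blast
  let ?J = "{x0 - \<delta>..x0 + \<delta>}" and ?P = "{p0 - r..p0 + r}" and ?Q = "{q0 - r..q0 + r}"
  have box: "(x, p, q) \<in> ?S \<inter> ball ?z0 d" if "x \<in> ?J" "p \<in> ?P" "q \<in> ?Q" for x p q
  proof -
    have "norm (?z0 - (x, p, q)) \<le> norm (x0 - x) + (norm (p0 - p) + norm (q0 - q))"
      using norm_Pair_le[of "x0 - x" "(p0 - p, q0 - q)"] norm_Pair_le[of "p0 - p" "q0 - q"] by simp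
    also have "\<dots> < d"
      using that \<delta>(2) d(1) by (auto simp: r_def)
    finally show ?thesis
      using that \<delta>(3) by (auto simp: dist_norm)
  qed
  have lip: "\<bar>h (x, p, q) - h (x, p', q')\<bar> \<le> M * \<bar>p - p'\<bar> + \<bar>q - q'\<bar> / 4"
    if "x \<in> ?J" "p \<in> ?P" "p' \<in> ?P" "q \<in> ?Q" "q' \<in> ?Q" for x p p' q q'
  proof -
    let ?R = "F (x, p, q) - F (x, p', q') - ((p - p') * D + (q - q') * c)"
    have "\<bar>?R\<bar> \<le> norm ((x, p, q) - (x, p', q')) * (\<bar>c\<bar> / 4)"
      using d(2)[OF box[OF that(1,3,5)] box[OF that(1,2,4)]] by (simp add: F'_eq)
    also have "\<dots> \<le> (\<bar>p - p'\<bar> + \<bar>q - q'\<bar>) * (\<bar>c\<bar> / 4)"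
      using norm_Pair_le[of "p - p'" "q - q'"] by (intro mult_right_mono) (auto simp: norm_Pair)
    finally have R: "\<bar>?R\<bar> / \<bar>c\<bar> \<le> (\<bar>p - p'\<bar> + \<bar>q - q'\<bar>) / 4"
      using c by (simp add: field_simps)
    \<comment> \<open>The term \<open>(q - q') * c / c\<close> cancels \<open>q - q'\<close>,
      leaving only the remainder and the linear term in \<open>p\<close>.\<close>
    have "h (x, p, q) - h (x, p', q') = - (?R / c) - (p - p') * (D / c)"
      using c by (simp add: h_def field_simps)
    then have "\<bar>h (x, p, q) - h (x, p', q')\<bar> \<le> \<bar>?R / c\<bar> + \<bar>(p - p') * (D / c)\<bar>"
      by (metis abs_minus_cancel abs_triangle_ineq4)
    also have "\<dots> \<le> (\<bar>p - p'\<bar> + \<bar>q - q'\<bar>) / 4 + \<bar>p - p'\<bar> * (\<bar>D\<bar> / \<bar>c\<bar>)"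
      using R by (simp add: abs_mult)
    also have "\<dots> = M * \<bar>p - p'\<bar> + \<bar>q - q'\<bar> / 4"
      by (simp add: M_def algebra_simps)
    finally show ?thesis .
  qed
  have h_cont: "continuous_on (?J \<times> ?P \<times> ?Q) h"
    unfolding h_def[abs_def] using \<delta>(3) c
    by (intro continuous_intros continuous_on_subset[OF F_cont]) auto
  have near: "\<bar>h (x, p0, q0) - q0\<bar> \<le> r / 4" if "x \<in> ?J" for x
    using \<delta>(7)[OF that] c by (simp add: h_def field_simps)
  obtain v where v: "continuous_on ?J v" "\<And>x. x \<in> ?J \<Longrightarrow> v x \<in> ?Q"
    "\<And>x. x \<in> ?J \<Longrightarrow> p0 + integral_from (x0 - \<delta>) x0 v x \<in> ?P"
    "\<And>x. x \<in> ?J \<Longrightarrow> h (x, p0 + integral_from (x0 - \<delta>) x0 v x, v x) = v x"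
    by (rule integral_fixed_point[OF h_cont lip near, of x0]) (use \<delta> pos in auto)
  define u where "u x = p0 + integral_from (x0 - \<delta>) x0 v x" for x
  have u': "(u has_real_derivative v x) (at x within ?J)" if "x \<in> ?J" for x
    unfolding u_def[abs_def] using integral_from_has_real_derivative[OF v(1) that]
    by (auto intro!: derivative_eq_intros)
  \<comment> \<open>At \<open>x0\<close> the integral vanishes, so \<open>v x0\<close> and
    \<open>q0\<close> are both fixed points of \<open>h (x0, p0, _)\<close>. Its Lipschitz constant
    1/4 forces them to agree.\<close>
  have "h (x0, p0, v x0) = v x0" "h (x0, p0, q0) = q0"
    using v(4)[of x0] \<delta>(1) assms(4) by (simp_all add: h_def)
  then have "\<bar>v x0 - q0\<bar> \<le> \<bar>v x0 - q0\<bar> / 4"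
    using lip[of x0 p0 p0 "v x0" q0] v(2)[of x0] \<delta>(1) pos(1) by simp
  then have "v x0 = q0"
    by simp
  moreover have "F (x, u x, v x) = 0" if "x \<in> ?J" for x
    using v(4)[OF that] c by (simp add: h_def u_def)
  moreover have "C1_on u ?J"
    using u' v(1) by (rule C1_on_real_derivative)
  moreover have "continuous_on (?J \<times> ?P) (\<lambda>z. v (fst z))"
    by (rule continuous_on_compose2[OF v(1)]) (auto intro!: continuous_intros)
  moreover have "u x \<in> ?P" if "x \<in> ?J" for x
    using v(3)[OF that] by (simp add: u_def)
  ultimately show ?thesis
    using \<delta>(1,3) pos(1) u'
    by (intro exI[of _ \<delta>] exI[of _ r] exI[of _ u] exI[of _ "\<lambda>z. v (fst z)"] conjI ballI) simp_all
qed

end
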